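(* Consider the dynamics $$\frac{\partial h_h(t,c)}{\partial t} = A_h h_h(t,c) + A_{h\psi}\psi(t) + B_h x(t,c),$$ $$\frac{\partial h_v(t,c)}{\partial t} = A_v h_v(t,c) + A_{v\psi}\psi(t) + A_{vh}h_h(t,c) + B_v x(t,c).$$ Assume $A_h, A_v, A_{h\psi}, A_{v\psi}, A_{vh}, B_h, B_v$ are variable-shared (independent of $c$), and let $\psi(t) := \phi\big(\{W_v z(t,c)\}_{c=1}^C\big)$ with a permutation-invariant $\phi$. For any permutation $\pi$ of $\{1,\dots,C\}$, consider the permuted inputs $x^\pi(t,c) := x(t,\pi(c))$ and permuted initial states $h^\pi(0,c) := h(0,\pi(c))$ (for both $h=h_h$ and $h=h_v$). Then the unique solutions to the dynamics satisfy $$h_h^\pi(t,c) = h_h(t,\pi(c)), \qquad h_v^\pi(t,c) = h_v(t,\pi(c)) \qquad \forall\, t, c,$$ i.e., the dynamics are permutation equivariant with respect to the variable axis.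
   Context: $c\in\{1,\dots,C\}$ indexes the variables of a multivariate time series and $t$ is time. $h_h(t,c)\in\mathbb{R}^{d_h}$ and $h_v(t,c)\in\mathbb{R}^{d_v}$ are the horizontal (temporal) and vertical (variable) states of variable $c$, and $x(t,c)$ is its input; the matrices are of compatible sizes. $z(t,:)=[z(t,1),\dots,z(t,C)]\in\mathbb{R}^{C\times d_z}$ is the ensemble of a variable-indexed representation at time $t$, $W_v$ is a learnable projection matrix that is variable-shared (independent of $c$), and $\phi$ is a permutation-invariant set function (e.g. mean, sum, or attention-based pooling), meaning $\phi(\{z_c\})=\phi(\{z_{\pi(c)}\})$ for every permutation $\pi$ of $\{1,\dots,C\}$; consequently the descriptor $\psi_\pi(t):=\phi(\{W_v z(t,\pi(c))\}_{c=1}^C)$ built from the permuted representation equals $\psi(t)$ for all $t$. $(h_h,h_v)$ denotes the unique solution with input $x$ and initial states $h_h(0,\cdot),h_v(0,\cdot)$, and $(h_h^\pi,h_v^\pi)$ the unique solution with input $x^\pi$ and the permuted initial states. *)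

theory Defs
  imports "HOL-Analysis.Analysis"
begin

text \<open>
  The variables of the series are the elements of a finite type \<open>'c\<close>. The set function \<open>\<phi>\<close>
  takes the \<open>'c\<close>-indexed family of its arguments, so that multiplicities are
  kept (as they must be for sums and means).
\<close>

definition permutation_invariant :: "(('c::finite \<Rightarrow> 'a) \<Rightarrow> 'b) \<Rightarrow> bool" where
  "permutation_invariant \<phi> \<longleftrightarrow>
     (\<forall>\<pi> v. \<pi> permutes UNIV \<longrightarrow> \<phi> (\<lambda>c. v (\<pi> c)) = \<phi> v)"

definition descriptor ::
  "(('c::finite \<Rightarrow> real ^ 'w) \<Rightarrow> real ^ 'p) \<Rightarrow> real ^ 'z ^ 'w \<Rightarrow> (real \<Rightarrow> 'c \<Rightarrow> real ^ 'z)
   \<Rightarrow> real \<Rightarrow> real ^ 'p" where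
  "descriptor \<phi> W\<^sub>v z t = \<phi> (\<lambda>c. W\<^sub>v *v z t c)"

text \<open>
  Classical solutions on a time interval \<open>T\<close>; at an endpoint belonging to \<open>T\<close> the
  time derivative is one-sided.
\<close>

definition solves_dynamics ::
  "real set \<Rightarrow> real ^ 'h ^ 'h \<Rightarrow> real ^ 'p ^ 'h \<Rightarrow> real ^ 'x ^ 'h
   \<Rightarrow> real ^ 'v ^ 'v \<Rightarrow> real ^ 'p ^ 'v \<Rightarrow> real ^ 'h ^ 'v \<Rightarrow> real ^ 'x ^ 'v
   \<Rightarrow> (real \<Rightarrow> real ^ 'p) \<Rightarrow> (real \<Rightarrow> 'c::finite \<Rightarrow> real ^ 'x)
   \<Rightarrow> (real \<Rightarrow> 'c \<Rightarrow> real ^ 'h) \<Rightarrow> (real \<Rightarrow> 'c \<Rightarrow> real ^ 'v) \<Rightarrow> bool" where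
  "solves_dynamics T A\<^sub>h A\<^sub>h\<^sub>\<psi> B\<^sub>h A\<^sub>v A\<^sub>v\<^sub>\<psi> A\<^sub>v\<^sub>h B\<^sub>v \<psi> x h\<^sub>h h\<^sub>v \<longleftrightarrow>
     (\<forall>t\<in>T. \<forall>c.
        ((\<lambda>s. h\<^sub>h s c) has_vector_derivative
           (A\<^sub>h *v h\<^sub>h t c + A\<^sub>h\<^sub>\<psi> *v \<psi> t + B\<^sub>h *v x t c)) (at t within T) \<and>
        ((\<lambda>s. h\<^sub>v s c) has_vector_derivative
           (A\<^sub>v *v h\<^sub>v t c + A\<^sub>v\<^sub>\<psi> *v \<psi> t + A\<^sub>v\<^sub>h *v h\<^sub>h t c + B\<^sub>v *v x t c)) (at t within T))"

end

(* Permuting a solution gives a solution of the dynamics for the permuted input, because the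
   descriptor does not change and all matrices are shared. The difference of two solutions with
   the same initial states satisfies a homogeneous linear equation; the horizontal difference
   vanishes by Gronwall's argument, which makes the vertical equation homogeneous as well. *)

theory Submission
  imports Defs
begin

text \<open>Gronwall's argument in differential form: a suitably damped squared norm of
  \<open>y\<close> cannot increase, starts at zero and is never negative. An inner product space is
  used so that the squared norm is differentiable even where \<open>y\<close> vanishes.\<close>

lemma zero_if_derivative_norm_bounded_forward:
  fixes y :: "real \<Rightarrow> 'a::real_inner"
  assumes b: "0 \<le> b" and y0: "y 0 = 0"
    and der: "\<And>t. t \<in> {0..b} \<Longrightarrow> (y has_vector_derivative y' t) (at t within {0..b})"
    and bound: "\<And>t. t \<in> {0..b} \<Longrightarrow> norm (y' t) \<le> K * norm (y t)"
  shows "y b = 0"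
proof -
  \<comment> \<open>Since the derivative of \<open>y t \<bullet> y t\<close> is at most
    \<open>2 * K * (y t \<bullet> y t)\<close>, this weight cancels the largest possible
    growth.\<close>
  define g where "g t = exp (- 2 * K * t) * (y t \<bullet> y t)" for t
  have cont: "continuous_on {0..b} g"
    unfolding g_def
    by (intro continuous_intros continuous_on_vector_derivative[OF der])
  have "g b \<le> g 0"
  \<comment> \<open>The sign of the derivative is checked only at interior points, where the
    derivative within the interval is a two-sided one; continuity of \<open>g\<close> takes care of
    the endpoints.\<close>
  proof (rule DERIV_nonpos_imp_decreasing_open[OF b _ cont])
    fix t assume t: "0 < t" "t < b"
    have "(y has_vector_derivative y' t) (at t)"
      using der[of t] t by (simp add: at_within_Icc_at)
    then have "((\<lambda>s. y s \<bullet> y s) has_real_derivative 2 * (y t \<bullet> y' t)) (at t)"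
      unfolding has_vector_derivative_def has_field_derivative_def
      by (auto intro!: derivative_eq_intros simp: inner_commute algebra_simps)
    then have "(g has_real_derivative 2 * exp (- 2 * K * t) * (y t \<bullet> y' t - K * (y t \<bullet> y t))) (at t)"
      unfolding g_def by (auto intro!: derivative_eq_intros simp: algebra_simps)
    moreover
    have "y t \<bullet> y' t \<le> K * (y t \<bullet> y t)"
    proof -
      have "y t \<bullet> y' t \<le> norm (y t) * norm (y' t)"
        by (rule norm_cauchy_schwarz)
      also have "\<dots> \<le> norm (y t) * (K * norm (y t))"
        using bound[of t] t by (intro mult_left_mono) auto
      finally show ?thesis
        by (simp add: dot_square_norm power2_eq_square mult.left_commute)
    qed
    then have "2 * exp (- 2 * K * t) * (y t \<bullet> y' t - K * (y t \<bullet> y t)) \<le> 0"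
      by (intro mult_nonneg_nonpos) auto
    ultimately show "\<exists>d. (g has_real_derivative d) (at t) \<and> d \<le> 0"
      by blast
  qed
  then show ?thesis
    by (simp add: g_def y0 mult_le_0_iff flip: power2_norm_eq_inner)
qed

text \<open>An interval \<open>T\<close> contains the whole segment between \<open>0\<close> and
  \<open>t\<close>, so the derivatives can be restricted to that segment. For negative
  \<open>t\<close>, reversing time reduces the claim to the forward case.\<close>

lemma zero_if_derivative_norm_bounded:
  fixes y :: "real \<Rightarrow> 'a::real_inner"
  assumes T: "is_interval T" "0 \<in> T" "t \<in> T" and y0: "y 0 = 0"
    and der: "\<And>t. t \<in> T \<Longrightarrow> (y has_vector_derivative y' t) (at t within T)"
    and bound: "\<And>t. t \<in> T \<Longrightarrow> norm (y' t) \<le> K * norm (y t)"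
  shows "y t = 0"
proof (cases "0 \<le> t")
  case True
  then have sub: "{0..t} \<subseteq> T"
    using mem_is_interval_1_I[OF T] by auto
  show ?thesis
  proof (rule zero_if_derivative_norm_bounded_forward[where y = y and y' = y' and K = K, OF True y0])
    fix s assume "s \<in> {0..t}"
    then have "s \<in> T" using sub by blast
    then show "(y has_vector_derivative y' s) (at s within {0..t})"
      and "norm (y' s) \<le> K * norm (y s)"
      using has_vector_derivative_within_subset[OF der sub] bound by auto
  qed
next
  case False
  have sub: "uminus ` {0..-t} \<subseteq> T"
    using mem_is_interval_1_I[OF T(1,3,2)] by auto
  have "(y \<circ> uminus) (-t) = 0"
  proof (rule zero_if_derivative_norm_bounded_forward[where y' = "\<lambda>s. - y' (- s)" and K = K])
    fix s assume "s \<in> {0..-t}"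
    then have "- s \<in> T" using sub by blast
    \<comment> \<open>The chain rule for \<open>y \<circ> uminus\<close> asks for the derivative of
      \<open>y\<close> within the reflected segment.\<close>
    then have "(y has_vector_derivative y' (- s)) (at (- s) within uminus ` {0..-t})"
      using sub by (intro has_vector_derivative_within_subset[OF der])
    moreover have "(uminus has_vector_derivative - 1) (at s within {0..-t})"
      by (auto intro!: derivative_eq_intros)
    ultimately show "((y \<circ> uminus) has_vector_derivative - y' (- s)) (at s within {0..-t})"
      using vector_diff_chain_within[of uminus "- 1" s "{0..-t}" y "y' (- s)"] by simp
    show "norm (- y' (- s)) \<le> K * norm ((y \<circ> uminus) s)"
      using bound[OF \<open>- s \<in> T\<close>] by simp
  qed (use False y0 in auto)
  then show ?thesis by simp
qed

text \<open>The operator norm of \<open>A\<close> serves as the Gronwall constant.\<close>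

lemma linear_ode_zero:
  fixes A :: "real ^ 'n ^ 'n"
  assumes "is_interval T" "0 \<in> T" "t \<in> T" "y 0 = 0"
    and "\<And>t. t \<in> T \<Longrightarrow> (y has_vector_derivative A *v y t) (at t within T)"
  shows "y t = 0"
  by (rule zero_if_derivative_norm_bounded[OF assms, where K = "onorm ((*v) A)"])
    (simp_all add: onorm[OF matrix_vector_mul_bounded_linear])

text \<open>With \<open>\<psi>\<close> a prescribed function of time, the equations at one variable
  involve no other variable, and their coefficients do not depend on the variable. Permuting
  therefore only relabels the equations.\<close>

lemma solves_dynamics_permute:
  assumes "solves_dynamics T A\<^sub>h A\<^sub>h\<^sub>\<psi> B\<^sub>h A\<^sub>v A\<^sub>v\<^sub>\<psi> A\<^sub>v\<^sub>h B\<^sub>v \<psi> x h\<^sub>h h\<^sub>v"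
  shows "solves_dynamics T A\<^sub>h A\<^sub>h\<^sub>\<psi> B\<^sub>h A\<^sub>v A\<^sub>v\<^sub>\<psi> A\<^sub>v\<^sub>h B\<^sub>v \<psi> (\<lambda>t c. x t (\<pi> c))
           (\<lambda>t c. h\<^sub>h t (\<pi> c)) (\<lambda>t c. h\<^sub>v t (\<pi> c))"
  using assms by (simp add: solves_dynamics_def)

text \<open>Both solutions are driven by the same \<open>\<psi>\<close> and \<open>x\<close>, so
  these terms cancel in the difference. This allows the comparison to be made at a single variable
  \<open>c\<close>.\<close>

lemma solves_dynamics_unique:
  assumes T: "is_interval T" "0 \<in> T"
    and sol: "solves_dynamics T A\<^sub>h A\<^sub>h\<^sub>\<psi> B\<^sub>h A\<^sub>v A\<^sub>v\<^sub>\<psi> A\<^sub>v\<^sub>h B\<^sub>v \<psi> x h\<^sub>h h\<^sub>v"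
      "solves_dynamics T A\<^sub>h A\<^sub>h\<^sub>\<psi> B\<^sub>h A\<^sub>v A\<^sub>v\<^sub>\<psi> A\<^sub>v\<^sub>h B\<^sub>v \<psi> x g\<^sub>h g\<^sub>v"
    and init: "h\<^sub>h 0 c = g\<^sub>h 0 c" "h\<^sub>v 0 c = g\<^sub>v 0 c"
    and t: "t \<in> T"
  shows "h\<^sub>h t c = g\<^sub>h t c \<and> h\<^sub>v t c = g\<^sub>v t c"
proof -
  \<comment> \<open>Stated for every time in \<open>T\<close>, since the vertical equation needs the
    coupling term through \<open>A\<^sub>v\<^sub>h\<close> to cancel at all times.\<close>
  have h: "h\<^sub>h s c - g\<^sub>h s c = 0" if "s \<in> T" for s
  proof (rule linear_ode_zero[OF T that, where A = A\<^sub>h])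
    fix s assume "s \<in> T"
    then have "((\<lambda>s. h\<^sub>h s c - g\<^sub>h s c) has_vector_derivative
        (A\<^sub>h *v h\<^sub>h s c + A\<^sub>h\<^sub>\<psi> *v \<psi> s + B\<^sub>h *v x s c)
        - (A\<^sub>h *v g\<^sub>h s c + A\<^sub>h\<^sub>\<psi> *v \<psi> s + B\<^sub>h *v x s c)) (at s within T)"
      using sol unfolding solves_dynamics_def by (intro has_vector_derivative_diff) auto
    then show "((\<lambda>s. h\<^sub>h s c - g\<^sub>h s c) has_vector_derivative A\<^sub>h *v (h\<^sub>h s c - g\<^sub>h s c))
        (at s within T)"
      by (simp add: matrix_vector_mult_diff_distrib)
  qed (simp add: init)
  moreover have "h\<^sub>v t c - g\<^sub>v t c = 0"
  proof (rule linear_ode_zero[OF T t, where A = A\<^sub>v])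
    fix s assume s: "s \<in> T"
    then have "((\<lambda>s. h\<^sub>v s c - g\<^sub>v s c) has_vector_derivative
        (A\<^sub>v *v h\<^sub>v s c + A\<^sub>v\<^sub>\<psi> *v \<psi> s + A\<^sub>v\<^sub>h *v h\<^sub>h s c + B\<^sub>v *v x s c)
        - (A\<^sub>v *v g\<^sub>v s c + A\<^sub>v\<^sub>\<psi> *v \<psi> s + A\<^sub>v\<^sub>h *v g\<^sub>h s c + B\<^sub>v *v x s c)) (at s within T)"
      using sol unfolding solves_dynamics_def by (intro has_vector_derivative_diff) auto
    then show "((\<lambda>s. h\<^sub>v s c - g\<^sub>v s c) has_vector_derivative A\<^sub>v *v (h\<^sub>v s c - g\<^sub>v s c))
        (at s within T)"
      using h[OF s] by (simp add: matrix_vector_mult_diff_distrib)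
  qed (simp add: init)
  ultimately show ?thesis using t by simp
qed

text \<open>Because \<open>W\<^sub>v\<close> is shared, permuting \<open>z\<close> before the
  projection permutes the projected family, and \<open>\<phi>\<close> ignores that.\<close>

lemma descriptor_permute:
  assumes "permutation_invariant \<phi>" "\<pi> permutes UNIV"
  shows "descriptor \<phi> W\<^sub>v (\<lambda>t c. z t (\<pi> c)) = descriptor \<phi> W\<^sub>v z"
proof
  fix t
  show "descriptor \<phi> W\<^sub>v (\<lambda>t c. z t (\<pi> c)) t = descriptor \<phi> W\<^sub>v z t"
    using assms(1)[unfolded permutation_invariant_def, rule_format, OF assms(2),
        of "\<lambda>c. W\<^sub>v *v z t c"]
    by (simp add: descriptor_def)
qed

theorem proposition2:
  fixes T :: "real set"
    and A\<^sub>h :: "real ^ 'h ^ 'h" and A\<^sub>h\<^sub>\<psi> :: "real ^ 'p ^ 'h" and B\<^sub>h :: "real ^ 'x ^ 'h"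
    and A\<^sub>v :: "real ^ 'v ^ 'v" and A\<^sub>v\<^sub>\<psi> :: "real ^ 'p ^ 'v" and A\<^sub>v\<^sub>h :: "real ^ 'h ^ 'v"
    and B\<^sub>v :: "real ^ 'x ^ 'v" and W\<^sub>v :: "real ^ 'z ^ 'w"
    and \<phi> :: "('c::finite \<Rightarrow> real ^ 'w) \<Rightarrow> real ^ 'p"
    and z :: "real \<Rightarrow> 'c \<Rightarrow> real ^ 'z" and x :: "real \<Rightarrow> 'c \<Rightarrow> real ^ 'x"
    and h\<^sub>h h\<^sub>h\<^sub>\<pi> :: "real \<Rightarrow> 'c \<Rightarrow> real ^ 'h" and h\<^sub>v h\<^sub>v\<^sub>\<pi> :: "real \<Rightarrow> 'c \<Rightarrow> real ^ 'v"
    and \<pi> :: "'c \<Rightarrow> 'c"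
  assumes "is_interval T" and "0 \<in> T"
    and "permutation_invariant \<phi>"
    and "\<pi> permutes UNIV"
    and "solves_dynamics T A\<^sub>h A\<^sub>h\<^sub>\<psi> B\<^sub>h A\<^sub>v A\<^sub>v\<^sub>\<psi> A\<^sub>v\<^sub>h B\<^sub>v
           (descriptor \<phi> W\<^sub>v z) x h\<^sub>h h\<^sub>v"
    and "solves_dynamics T A\<^sub>h A\<^sub>h\<^sub>\<psi> B\<^sub>h A\<^sub>v A\<^sub>v\<^sub>\<psi> A\<^sub>v\<^sub>h B\<^sub>v
           (descriptor \<phi> W\<^sub>v (\<lambda>t c. z t (\<pi> c))) (\<lambda>t c. x t (\<pi> c)) h\<^sub>h\<^sub>\<pi> h\<^sub>v\<^sub>\<pi>"
    and "\<And>c. h\<^sub>h\<^sub>\<pi> 0 c = h\<^sub>h 0 (\<pi> c)"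
    and "\<And>c. h\<^sub>v\<^sub>\<pi> 0 c = h\<^sub>v 0 (\<pi> c)"
  shows "\<forall>t\<in>T. \<forall>c. h\<^sub>h\<^sub>\<pi> t c = h\<^sub>h t (\<pi> c) \<and> h\<^sub>v\<^sub>\<pi> t c = h\<^sub>v t (\<pi> c)"
  \<comment> \<open>Rewriting the descriptor in the permuted system gives it the same forcing as the
    relabelled original solution, so uniqueness applies to these two.\<close>
  using solves_dynamics_unique[OF assms(1,2)
      assms(6)[unfolded descriptor_permute[OF assms(3,4)]]
      solves_dynamics_permute[OF assms(5)] assms(7,8)]
  by blast

end
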